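(* Let $\mu,\nu,c,d\in\mathbb{C}$ with $|\mu|\le 1$ and $|\nu|\le 1$, let $\Phi_1(z)=\mu z+c$ and $\Phi_2(z)=\nu z+d$, and let $\Upsilon_1,\Upsilon_2$ be entire functions on $\mathbb{C}$ such that the weighted composition operators $C_{\Upsilon_1,\Phi_1}$ and $C_{\Upsilon_2,\Phi_2}$ are bounded on $H_E(\zeta)$. Then $C_{\Upsilon_1,\Phi_1}^*=C_{\Upsilon_2,\Phi_2}$ if and only if $$\Upsilon_1(z)=\zeta_0^2\,\Upsilon_1(0)\,K_{\Phi_2(0)}(z)\quad\text{and}\quad \Upsilon_2(z)=\zeta_0^2\,\overline{\Upsilon_1(0)}\,K_{\Phi_1(0)}(z)\quad\text{for all } z\in\mathbb{C},$$ and, according to the value of $\Upsilon_1(0)$, the corresponding one of the following is true: (i) if $\Upsilon_1(0)=0$, then $\Upsilon_1\equiv 0$ and $\Upsilon_2\equiv 0$, and consequently $C_{\Upsilon_1,\Phi_1}\equiv 0$ and $C_{\Upsilon_2,\Phi_2}\equiv 0$; (ii) if $\Upsilon_1(0)\ne 0$, then $$K_z(\Phi_2(0))\,K_{\Phi_1(z)}(w)=K_{\Phi_1(0)}(w)\,K_z(\Phi_2(w))\quad\text{for all } z,w\in\mathbb{C}.$$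
   Context: Let $\mathbb{N}_0=\mathbb{N}\cup\{0\}$ and let $\zeta=(\zeta_n)_{n\in\mathbb{N}_0}$ be a sequence of positive real numbers with $\lim_{n\to\infty}\zeta_n^{1/n}=\infty$. The weighted Hardy space of entire functions induced by $\zeta$ is the Hilbert space $H_E(\zeta)=\{g(z)=\sum_{n=0}^\infty b_nz^n : \|g\|^2=\sum_{n=0}^\infty |b_n|^2\zeta_n^2<\infty\}$ of entire functions on $\mathbb{C}$, with inner product $\langle g,h\rangle=\sum_{n=0}^\infty b_n\overline{c_n}\zeta_n^2$ for $g(z)=\sum b_nz^n$ and $h(z)=\sum c_nz^n$ in $H_E(\zeta)$. For $p\in\mathbb{C}$, the reproducing kernel is $K_p(w)=\sum_{n=0}^\infty \frac{1}{\zeta_n^2}\overline{p}^{\,n}w^n$ for $w\in\mathbb{C}$, which satisfies $f(p)=\langle f,K_p\rangle$ for all $f\in H_E(\zeta)$. For entire functions $\Upsilon,\Phi:\mathbb{C}\to\mathbb{C}$, the weighted composition operator is $C_{\Upsilon,\Phi}f=\Upsilon\cdot(f\circ\Phi)$; it is bounded on $H_E(\zeta)$ if it maps $H_E(\zeta)$ into itself as a bounded linear operator. The adjoint $C_{\Upsilon,\Phi}^*$ is the Hilbert space adjoint. *)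

theory Defs
  imports "HOL-Complex_Analysis.Complex_Analysis"
begin

definition taylor_coeff :: "(complex \<Rightarrow> complex) \<Rightarrow> nat \<Rightarrow> complex" where
  "taylor_coeff g n = fps_nth (fps_expansion g 0) n"

definition hardy_space :: "(nat \<Rightarrow> real) \<Rightarrow> (complex \<Rightarrow> complex) set" where
  "hardy_space \<zeta> =
     {g. g holomorphic_on UNIV \<and> summable (\<lambda>n. (cmod (taylor_coeff g n))\<^sup>2 * (\<zeta> n)\<^sup>2)}"

definition hardy_inner ::
    "(nat \<Rightarrow> real) \<Rightarrow> (complex \<Rightarrow> complex) \<Rightarrow> (complex \<Rightarrow> complex) \<Rightarrow> complex" where
  "hardy_inner \<zeta> g h =
     (\<Sum>n. taylor_coeff g n * cnj (taylor_coeff h n) * complex_of_real ((\<zeta> n)\<^sup>2))"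

definition hardy_norm :: "(nat \<Rightarrow> real) \<Rightarrow> (complex \<Rightarrow> complex) \<Rightarrow> real" where
  "hardy_norm \<zeta> g = sqrt (\<Sum>n. (cmod (taylor_coeff g n))\<^sup>2 * (\<zeta> n)\<^sup>2)"

definition repr_kernel :: "(nat \<Rightarrow> real) \<Rightarrow> complex \<Rightarrow> complex \<Rightarrow> complex" where
  "repr_kernel \<zeta> p w = (\<Sum>n. complex_of_real (1 / (\<zeta> n)\<^sup>2) * cnj p ^ n * w ^ n)"

definition wcomp ::
    "(complex \<Rightarrow> complex) \<Rightarrow> (complex \<Rightarrow> complex) \<Rightarrow> (complex \<Rightarrow> complex) \<Rightarrow> complex \<Rightarrow> complex" where
  "wcomp \<Upsilon> \<Phi> f = (\<lambda>z. \<Upsilon> z * (f \<circ> \<Phi>) z)"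

definition bounded_operator_on_hardy ::
    "(nat \<Rightarrow> real) \<Rightarrow> ((complex \<Rightarrow> complex) \<Rightarrow> complex \<Rightarrow> complex) \<Rightarrow> bool" where
  "bounded_operator_on_hardy \<zeta> T \<longleftrightarrow>
     (\<forall>f \<in> hardy_space \<zeta>. T f \<in> hardy_space \<zeta>) \<and>
     (\<forall>f \<in> hardy_space \<zeta>. \<forall>g \<in> hardy_space \<zeta>. \<forall>a b.
        T (\<lambda>z. a * f z + b * g z) = (\<lambda>z. a * T f z + b * T g z)) \<and>
     (\<exists>M. \<forall>f \<in> hardy_space \<zeta>. hardy_norm \<zeta> (T f) \<le> M * hardy_norm \<zeta> f)"

text \<open>
  The Hilbert space adjoint. For a bounded operator \<open>T\<close> and \<open>g\<close> in the space, the Riesz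
  representation theorem provides exactly one \<open>h\<close> as below. The value is meaningful only for
  \<open>g\<close> in the space, so operators have to be compared on \<^term>\<open>hardy_space \<zeta>\<close> only.
\<close>

definition hardy_adjoint ::
    "(nat \<Rightarrow> real) \<Rightarrow> ((complex \<Rightarrow> complex) \<Rightarrow> complex \<Rightarrow> complex) \<Rightarrow>
     (complex \<Rightarrow> complex) \<Rightarrow> complex \<Rightarrow> complex" where
  "hardy_adjoint \<zeta> T g =
     (THE h. h \<in> hardy_space \<zeta> \<and>
        (\<forall>f \<in> hardy_space \<zeta>. hardy_inner \<zeta> (T f) g = hardy_inner \<zeta> f h))"

end

theory Submission
  imports Defs
begin

text \<open>
  Testing the adjoint on reproducing kernels turns \<open>C\<^sub>1\<^sup>* = C\<^sub>2\<close> into the functional equation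
  \<open>cnj (\<Upsilon>\<^sub>1 z) * K\<^bsub>\<Phi>\<^sub>1 z\<^esub> w = \<Upsilon>\<^sub>2 w * K\<^sub>z (\<Phi>\<^sub>2 w)\<close>, and setting \<open>z = 0\<close> and \<open>w = 0\<close> in it gives the two
  formulas for the weights. Conversely, the functional equation says that
  \<open>C\<^sub>1 K\<^sub>w = cnj (\<Upsilon>\<^sub>2 w) K\<^bsub>\<Phi>\<^sub>2 w\<^esub>\<close>, so \<open>cnj (C\<^sub>2 g w) = \<langle>C\<^sub>1 K\<^sub>w, g\<rangle>\<close>. By continuity of \<open>C\<^sub>1\<close> the right-hand
  side is the power series in \<open>cnj w\<close> with coefficients \<open>\<langle>C\<^sub>1 z\<^sup>n, g\<rangle> / \<zeta>\<^sub>n\<^sup>2\<close>; comparing Taylor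
  coefficients yields \<open>\<langle>C\<^sub>1 z\<^sup>n, g\<rangle> = \<langle>z\<^sup>n, C\<^sub>2 g\<rangle>\<close>, and continuity extends this from monomials to the whole
  space. No Riesz representation is needed, because \<open>C\<^sub>2 g\<close> is known to lie in the space.
\<close>

section \<open>Taylor coefficients of entire functions\<close>

lemma taylor_coeff_sums:
  assumes "f holomorphic_on UNIV"
  shows "(\<lambda>n. taylor_coeff f n * z ^ n) sums f z"
  using holomorphic_power_series[of f 0 "norm z + 1" z] assms
  by (auto simp: taylor_coeff_def fps_expansion_def intro: holomorphic_on_subset)

text \<open>A power series that converges everywhere is holomorphic on every ball around 0, and its
  expansion there is unique. Exhibiting such a series is how coefficients are computed
  below.\<close>

lemma
  assumes "\<And>z. (\<lambda>n. a n * z ^ n) sums f z"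
  shows holomorphic_on_UNIV_if_sums: "f holomorphic_on UNIV"
    and taylor_coeff_eqI: "taylor_coeff f n = a n"
proof -
  show "f holomorphic_on UNIV"
    unfolding holomorphic_on_open[OF open_UNIV]
  proof
    fix z :: complex
    have "f holomorphic_on ball 0 (norm z + 1)"
      by (rule power_series_holomorphic[where a = a]) (use assms in auto)
    then show "\<exists>f'. (f has_field_derivative f') (at z)"
      by (auto simp: holomorphic_on_open)
  qed
  have "f has_fps_expansion Abs_fps a"
    by (rule has_fps_expansionI) (use assms in auto)
  then have "fps_expansion f 0 = Abs_fps a"
    by (rule fps_expansion_eqI)
  then show "taylor_coeff f n = a n"
    by (simp add: taylor_coeff_def)
qed

lemma entire_eqI_taylor_coeff:
  assumes "f holomorphic_on UNIV" "g holomorphic_on UNIV"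
    and "\<And>n. taylor_coeff f n = taylor_coeff g n"
  shows "f = g"
  using taylor_coeff_sums[OF assms(1)] taylor_coeff_sums[OF assms(2)] assms(3) sums_unique2
  by fastforce

lemma taylor_coeff_lincomb:
  assumes "f holomorphic_on UNIV" "g holomorphic_on UNIV"
  shows "taylor_coeff (\<lambda>z. a * f z + b * g z) n = a * taylor_coeff f n + b * taylor_coeff g n"
proof (rule taylor_coeff_eqI)
  fix z
  show "(\<lambda>n. (a * taylor_coeff f n + b * taylor_coeff g n) * z ^ n) sums (a * f z + b * g z)"
    using sums_add[OF sums_mult[OF taylor_coeff_sums[OF assms(1)], of a z]
        sums_mult[OF taylor_coeff_sums[OF assms(2)], of b z]]
    by (simp add: algebra_simps)
qed

lemma taylor_coeff_monom:
  "taylor_coeff (\<lambda>z. z ^ m) n = (if n = m then 1 else 0)"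
proof (rule taylor_coeff_eqI)
  fix z :: complex
  show "(\<lambda>n. (if n = m then 1 else 0) * z ^ n) sums z ^ m"
    using sums_single[of m "\<lambda>n. z ^ n"] by (simp add: if_distrib if_distribR cong: if_cong)
qed

lemma taylor_coeff_poly:
  "taylor_coeff (\<lambda>z. \<Sum>k<N. a k * z ^ k) n = (if n < N then a n else 0)"
proof (rule taylor_coeff_eqI)
  fix z :: complex
  show "(\<lambda>n. (if n < N then a n else 0) * z ^ n) sums (\<Sum>k<N. a k * z ^ k)"
    using sums_If_finite_set[of "{..<N}" "\<lambda>n. a n * z ^ n"]
    by (simp add: if_distrib if_distribR cong: if_cong)
qed

section \<open>The weighted Hardy space and its inner product\<close>

lemma hardy_space_holomorphic: "f \<in> hardy_space \<zeta> \<Longrightarrow> f holomorphic_on UNIV"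
  by (simp add: hardy_space_def)

lemma hardy_space_summable:
  "f \<in> hardy_space \<zeta> \<Longrightarrow> summable (\<lambda>n. (cmod (taylor_coeff f n))\<^sup>2 * (\<zeta> n)\<^sup>2)"
  by (simp add: hardy_space_def)

text \<open>The bound |x + y|^2 \<le> 2|x|^2 + 2|y|^2, applied to each coefficient, gives a summable
  majorant.\<close>

lemma hardy_space_lincomb:
  assumes "f \<in> hardy_space \<zeta>" "g \<in> hardy_space \<zeta>"
  shows "(\<lambda>z. a * f z + b * g z) \<in> hardy_space \<zeta>"
proof -
  let ?F = "\<lambda>n. (cmod (taylor_coeff f n))\<^sup>2 * (\<zeta> n)\<^sup>2"
  let ?G = "\<lambda>n. (cmod (taylor_coeff g n))\<^sup>2 * (\<zeta> n)\<^sup>2"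
  have hol: "f holomorphic_on UNIV" "g holomorphic_on UNIV"
    using assms hardy_space_holomorphic by auto
  have "summable (\<lambda>n. 2 * (cmod a)\<^sup>2 * ?F n + 2 * (cmod b)\<^sup>2 * ?G n)"
    by (intro summable_add summable_mult hardy_space_summable assms)
  moreover have "norm ((cmod (a * taylor_coeff f n + b * taylor_coeff g n))\<^sup>2 * (\<zeta> n)\<^sup>2)
      \<le> 2 * (cmod a)\<^sup>2 * ?F n + 2 * (cmod b)\<^sup>2 * ?G n" for n
  proof -
    let ?x = "cmod a * cmod (taylor_coeff f n)" and ?y = "cmod b * cmod (taylor_coeff g n)"
    have "cmod (a * taylor_coeff f n + b * taylor_coeff g n) \<le> ?x + ?y"
      by (metis norm_mult norm_triangle_ineq)
    then have "(cmod (a * taylor_coeff f n + b * taylor_coeff g n))\<^sup>2 \<le> (?x + ?y)\<^sup>2"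
      by (intro power_mono) auto
    also have "\<dots> \<le> 2 * ?x\<^sup>2 + 2 * ?y\<^sup>2"
      using sum_squares_bound[of ?x ?y] by (simp add: power2_sum)
    finally have "(cmod (a * taylor_coeff f n + b * taylor_coeff g n))\<^sup>2 * (\<zeta> n)\<^sup>2
        \<le> (2 * ?x\<^sup>2 + 2 * ?y\<^sup>2) * (\<zeta> n)\<^sup>2"
      by (rule mult_right_mono) simp
    then show ?thesis
      by (simp add: power_mult_distrib algebra_simps)
  qed
  ultimately have "summable (\<lambda>n. (cmod (a * taylor_coeff f n + b * taylor_coeff g n))\<^sup>2 * (\<zeta> n)\<^sup>2)"
    by (rule summable_comparison_test')
  then show ?thesis
    using hol by (auto simp: hardy_space_def taylor_coeff_lincomb intro!: holomorphic_intros)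
qed

lemma hardy_space_poly: "(\<lambda>z. \<Sum>k<N. a k * z ^ k) \<in> hardy_space \<zeta>"
proof -
  have "summable (\<lambda>n. (cmod (if n < N then a n else 0))\<^sup>2 * (\<zeta> n)\<^sup>2)"
    by (rule summable_finite[of "{..<N}"]) auto
  then show ?thesis
    by (auto simp: hardy_space_def taylor_coeff_poly intro!: holomorphic_intros)
qed

lemma hardy_space_monom: "(\<lambda>z. z ^ m) \<in> hardy_space \<zeta>"
proof -
  have "summable (\<lambda>n. (cmod (if n = m then 1 else 0))\<^sup>2 * (\<zeta> n)\<^sup>2)"
    by (rule summable_finite[of "{m}"]) auto
  then show ?thesis
    by (auto simp: hardy_space_def taylor_coeff_monom intro!: holomorphic_intros)
qed

text \<open>Finite Cauchy-Schwarz for the coefficient moduli multiplied by \<open>\<zeta> n\<close>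
  bounds all partial sums of absolute values by one constant. This gives absolute convergence and
  the inequality together.\<close>

lemma
  assumes "f \<in> hardy_space \<zeta>" "g \<in> hardy_space \<zeta>"
  shows summable_hardy_inner:
      "summable (\<lambda>n. taylor_coeff f n * cnj (taylor_coeff g n) * complex_of_real ((\<zeta> n)\<^sup>2))"
    and hardy_inner_Cauchy_Schwarz:
      "cmod (hardy_inner \<zeta> f g) \<le> hardy_norm \<zeta> f * hardy_norm \<zeta> g"
proof -
  let ?t = "\<lambda>n. taylor_coeff f n * cnj (taylor_coeff g n) * complex_of_real ((\<zeta> n)\<^sup>2)"
  have le_norm: "L2_set (\<lambda>n. cmod (taylor_coeff u n) * \<zeta> n) {..<N} \<le> hardy_norm \<zeta> u"
    if "u \<in> hardy_space \<zeta>" for u N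
    unfolding L2_set_def hardy_norm_def power_mult_distrib
    by (intro real_sqrt_le_mono sum_le_suminf hardy_space_summable that) auto
  have bound: "(\<Sum>n<N. cmod (?t n)) \<le> hardy_norm \<zeta> f * hardy_norm \<zeta> g" for N
  proof -
    have "(\<Sum>n<N. cmod (?t n))
        = (\<Sum>n<N. \<bar>cmod (taylor_coeff f n) * \<zeta> n\<bar> * \<bar>cmod (taylor_coeff g n) * \<zeta> n\<bar>)"
      by (intro sum.cong) (auto simp: norm_mult abs_mult power2_eq_square)
    also have "\<dots> \<le> L2_set (\<lambda>n. cmod (taylor_coeff f n) * \<zeta> n) {..<N}
        * L2_set (\<lambda>n. cmod (taylor_coeff g n) * \<zeta> n) {..<N}"
      by (rule L2_set_mult_ineq)
    also have "\<dots> \<le> hardy_norm \<zeta> f * hardy_norm \<zeta> g"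
      by (intro mult_mono le_norm assms L2_set_nonneg order_trans[OF L2_set_nonneg le_norm])
    finally show ?thesis .
  qed
  then have summ: "summable (\<lambda>n. cmod (?t n))"
    by (intro summableI_nonneg_bounded) auto
  then show "summable ?t"
    by (rule summable_norm_cancel)
  have "cmod (hardy_inner \<zeta> f g) \<le> (\<Sum>n. cmod (?t n))"
    unfolding hardy_inner_def by (rule summable_norm[OF summ])
  also have "\<dots> \<le> hardy_norm \<zeta> f * hardy_norm \<zeta> g"
    by (rule suminf_le_const[OF summ bound])
  finally show "cmod (hardy_inner \<zeta> f g) \<le> hardy_norm \<zeta> f * hardy_norm \<zeta> g" .
qed

lemma hardy_norm_nonneg: "f \<in> hardy_space \<zeta> \<Longrightarrow> 0 \<le> hardy_norm \<zeta> f"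
  unfolding hardy_norm_def
  by (intro real_sqrt_ge_zero suminf_nonneg hardy_space_summable) auto

lemma hardy_inner_lincomb_left:
  assumes "f \<in> hardy_space \<zeta>" "g \<in> hardy_space \<zeta>" "h \<in> hardy_space \<zeta>"
  shows "hardy_inner \<zeta> (\<lambda>z. a * f z + b * g z) h
    = a * hardy_inner \<zeta> f h + b * hardy_inner \<zeta> g h"
proof -
  have "(\<lambda>n. a * (taylor_coeff f n * cnj (taylor_coeff h n) * complex_of_real ((\<zeta> n)\<^sup>2))
      + b * (taylor_coeff g n * cnj (taylor_coeff h n) * complex_of_real ((\<zeta> n)\<^sup>2)))
      sums (a * hardy_inner \<zeta> f h + b * hardy_inner \<zeta> g h)"
    unfolding hardy_inner_def
    by (intro sums_add sums_mult summable_sums summable_hardy_inner assms)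
  then show ?thesis
    using assms[THEN hardy_space_holomorphic]
    by (simp add: hardy_inner_def taylor_coeff_lincomb algebra_simps sums_iff)
qed

lemma hardy_inner_scale_left:
  assumes "f \<in> hardy_space \<zeta>" "h \<in> hardy_space \<zeta>"
  shows "hardy_inner \<zeta> (\<lambda>z. a * f z) h = a * hardy_inner \<zeta> f h"
  using hardy_inner_lincomb_left[OF assms(1) assms(1) assms(2), of a 0] by simp

lemma hardy_inner_commute: "hardy_inner \<zeta> g f = cnj (hardy_inner \<zeta> f g)"
  if "f \<in> hardy_space \<zeta>" "g \<in> hardy_space \<zeta>"
proof -
  have "(\<lambda>n. cnj (taylor_coeff f n * cnj (taylor_coeff g n) * complex_of_real ((\<zeta> n)\<^sup>2)))
      sums cnj (hardy_inner \<zeta> f g)"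
    unfolding hardy_inner_def sums_cnj
    by (intro summable_sums summable_hardy_inner that)
  then show ?thesis
    by (simp add: hardy_inner_def sums_iff mult.commute)
qed

text \<open>Pairing with monomials isolates single coefficients; this is what later makes adjoints
  unique.\<close>

lemma hardy_inner_monom_left:
  "hardy_inner \<zeta> (\<lambda>z. z ^ m) h = cnj (taylor_coeff h m) * complex_of_real ((\<zeta> m)\<^sup>2)"
proof -
  have "(\<lambda>n. if n = m then cnj (taylor_coeff h n) * complex_of_real ((\<zeta> n)\<^sup>2) else 0)
      sums (cnj (taylor_coeff h m) * complex_of_real ((\<zeta> m)\<^sup>2))"
    by (rule sums_single)
  then show ?thesis
    by (simp add: hardy_inner_def taylor_coeff_monom sums_iff if_distrib if_distribR cong: if_cong)
qed

section \<open>Approximation by Taylor polynomials\<close>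

lemma hardy_norm_taylor_remainder_tendsto_0:
  assumes "f \<in> hardy_space \<zeta>"
  shows "(\<lambda>N. hardy_norm \<zeta> (\<lambda>z. 1 * f z + (- 1) * (\<Sum>k<N. taylor_coeff f k * z ^ k))) \<longlonglongrightarrow> 0"
proof -
  let ?F = "\<lambda>n. (cmod (taylor_coeff f n))\<^sup>2 * (\<zeta> n)\<^sup>2"
  have hol: "f holomorphic_on UNIV"
    using assms by (rule hardy_space_holomorphic)
  have "hardy_norm \<zeta> (\<lambda>z. 1 * f z + (- 1) * (\<Sum>k<N. taylor_coeff f k * z ^ k))
      = sqrt (suminf ?F - (\<Sum>n<N. ?F n))" for N
  proof -
    \<comment> \<open>Subtracting the polynomial deletes the first \<open>N\<close> coefficients, so
      the squared norm is a tail of a convergent series. The factors \<open>1\<close> and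
      \<open>- 1\<close> give the remainder the shape of the linear combinations in
      \<open>taylor_coeff_lincomb\<close>.\<close>
    have eq: "(cmod (taylor_coeff (\<lambda>z. 1 * f z + (- 1) * (\<Sum>k<N. taylor_coeff f k * z ^ k)) n))\<^sup>2
        * (\<zeta> n)\<^sup>2 = ?F n - (if n \<in> {..<N} then ?F n else 0)" for n
      by (subst taylor_coeff_lincomb) (auto simp: hol taylor_coeff_poly intro!: holomorphic_intros)
    have "(\<lambda>n. ?F n - (if n \<in> {..<N} then ?F n else 0)) sums (suminf ?F - (\<Sum>n<N. ?F n))"
      by (intro sums_diff summable_sums hardy_space_summable[OF assms] sums_If_finite_set) auto
    then show ?thesis
      unfolding hardy_norm_def eq by (simp only: sums_iff)
  qed
  moreover have "(\<lambda>N. sqrt (suminf ?F - (\<Sum>n<N. ?F n))) \<longlonglongrightarrow> sqrt (suminf ?F - suminf ?F)"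
    by (intro tendsto_intros summable_LIMSEQ hardy_space_summable assms)
  ultimately show ?thesis
    by simp
qed

text \<open>By Cauchy-Schwarz and boundedness of \<open>T\<close>, pairing \<open>T u\<close> with
  \<open>g\<close> is a continuous linear functional of \<open>u\<close>. Hence it may be applied
  termwise to the Taylor series of \<open>f\<close>, which converges in norm.\<close>

lemma bounded_operator_inner_sums:
  assumes T: "bounded_operator_on_hardy \<zeta> T"
    and f: "f \<in> hardy_space \<zeta>" and g: "g \<in> hardy_space \<zeta>"
  shows "(\<lambda>n. taylor_coeff f n * hardy_inner \<zeta> (T (\<lambda>z. z ^ n)) g) sums hardy_inner \<zeta> (T f) g"
proof -
  define L where "L u = hardy_inner \<zeta> (T u) g" for u
  let ?S = "\<lambda>N z. \<Sum>k<N. taylor_coeff f k * z ^ k"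
  have TH: "T u \<in> hardy_space \<zeta>" if "u \<in> hardy_space \<zeta>" for u
    using T that by (simp add: bounded_operator_on_hardy_def)
  have L_lin: "L (\<lambda>z. a * u z + b * v z) = a * L u + b * L v"
    if "u \<in> hardy_space \<zeta>" "v \<in> hardy_space \<zeta>" for a b u v
  proof -
    have "T (\<lambda>z. a * u z + b * v z) = (\<lambda>z. a * T u z + b * T v z)"
      using T that by (simp add: bounded_operator_on_hardy_def)
    then show ?thesis
      by (simp add: L_def hardy_inner_lincomb_left TH that g)
  qed
  obtain M where M: "hardy_norm \<zeta> (T u) \<le> M * hardy_norm \<zeta> u" if "u \<in> hardy_space \<zeta>" for u
    using T by (metis bounded_operator_on_hardy_def)
  have L_bound: "cmod (L u) \<le> M * hardy_norm \<zeta> u * hardy_norm \<zeta> g" if "u \<in> hardy_space \<zeta>" for u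
    unfolding L_def
    by (rule order_trans[OF hardy_inner_Cauchy_Schwarz[OF TH[OF that] g]])
      (intro mult_right_mono M that hardy_norm_nonneg g)
  have L_poly: "L (?S N) = (\<Sum>n<N. taylor_coeff f n * L (\<lambda>z. z ^ n))" for N
  proof (induction N)
    case 0
    \<comment> \<open>The empty sum is the zero function, written here as a combination with both
      coefficients 0.\<close>
    show ?case
      using L_lin[OF f f, of 0 0] by simp
  next
    case (Suc N)
    have "L (?S (Suc N)) = L (\<lambda>z. 1 * ?S N z + taylor_coeff f N * z ^ N)"
      by simp
    also have "\<dots> = 1 * L (?S N) + taylor_coeff f N * L (\<lambda>z. z ^ N)"
      by (rule L_lin[OF hardy_space_poly hardy_space_monom])
    finally show ?case
      using Suc.IH by simp
  qed
  \<comment> \<open>By linearity the difference is \<open>L\<close> of the Taylor remainder, so the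
    norm of the remainder controls it.\<close>
  have "(\<lambda>N. L f - L (?S N)) \<longlonglongrightarrow> 0"
  proof (rule Lim_null_comparison)
    let ?R = "\<lambda>N z. 1 * f z + (- 1) * ?S N z"
    have "cmod (L f - L (?S N)) \<le> M * hardy_norm \<zeta> (?R N) * hardy_norm \<zeta> g" for N
      using L_bound[OF hardy_space_lincomb[OF f hardy_space_poly], of 1 "- 1"]
        L_lin[OF f hardy_space_poly, of 1 "- 1"] by simp
    then show "\<forall>\<^sub>F N in sequentially. cmod (L f - L (?S N))
        \<le> M * hardy_norm \<zeta> (?R N) * hardy_norm \<zeta> g"
      by simp
    show "(\<lambda>N. M * hardy_norm \<zeta> (?R N) * hardy_norm \<zeta> g) \<longlonglongrightarrow> 0"
      by (intro tendsto_mult_left_zero tendsto_mult_right_zero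
          hardy_norm_taylor_remainder_tendsto_0 f)
  qed
  then have "(\<lambda>N. L f - (L f - L (?S N))) \<longlonglongrightarrow> L f - 0"
    by (intro tendsto_intros)
  then show ?thesis
    by (simp add: sums_def L_poly flip: L_def)
qed

section \<open>Weights and reproducing kernels\<close>

locale entire_weight =
  fixes \<zeta> :: "nat \<Rightarrow> real"
  assumes pos: "\<And>n. \<zeta> n > 0"
    and root_at_top: "filterlim (\<lambda>n. root n (\<zeta> n)) at_top sequentially"
begin

abbreviation "H \<equiv> hardy_space \<zeta>"
abbreviation "K \<equiv> repr_kernel \<zeta>"

lemma nz [simp]: "\<zeta> n \<noteq> 0"
  using pos[of n] by simp

text \<open>Since the roots of the weights tend to infinity, they eventually exceed
  \<open>sqrt (2 * r)\<close>. Then \<open>(\<zeta> n)\<^sup>2\<close> is at least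
  \<open>(2 * r) ^ n\<close>, and a geometric series of ratio 1/2 dominates. All convergence of
  kernel series rests on this bound.\<close>

lemma summable_power_div_weight:
  assumes "r \<ge> 0"
  shows "summable (\<lambda>n. r ^ n / (\<zeta> n)\<^sup>2)"
proof (rule summable_comparison_test_ev)
  have "eventually (\<lambda>n. sqrt (2 * r) \<le> root n (\<zeta> n)) sequentially"
    using root_at_top by (auto simp: filterlim_at_top)
  then show "eventually (\<lambda>n. norm (r ^ n / (\<zeta> n)\<^sup>2) \<le> (1 / 2) ^ n) sequentially"
    using eventually_gt_at_top[of 0]
  proof eventually_elim
    case (elim n)
    have "(sqrt (2 * r)) ^ n \<le> (root n (\<zeta> n)) ^ n"
      by (intro power_mono elim) (use assms in auto)
    \<comment> \<open>The index has to be positive here, because \<open>root 0\<close> is constantly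
      0.\<close>
    also have "\<dots> = \<zeta> n"
      using elim pos[of n] by (intro real_root_pow_pos2) auto
    finally have "((sqrt (2 * r)) ^ n)\<^sup>2 \<le> (\<zeta> n)\<^sup>2"
      by (intro power_mono) (use assms in auto)
    moreover have "((sqrt (2 * r)) ^ n)\<^sup>2 = (2 * r) ^ n"
    proof -
      have "((sqrt (2 * r)) ^ n)\<^sup>2 = ((sqrt (2 * r))\<^sup>2) ^ n"
        by (metis power_mult mult.commute)
      then show ?thesis
        using assms by simp
    qed
    ultimately have "2 ^ n * r ^ n \<le> (\<zeta> n)\<^sup>2"
      by (simp add: power_mult_distrib)
    then show ?case
      using assms by (simp add: field_simps power_divide)
  qed
qed (auto intro: summable_geometric)

lemma kernel_sums:
  "(\<lambda>n. complex_of_real (1 / (\<zeta> n)\<^sup>2) * cnj p ^ n * w ^ n) sums K p w"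
proof -
  have "summable (\<lambda>n. (cmod p * cmod w) ^ n / (\<zeta> n)\<^sup>2)"
    by (rule summable_power_div_weight) simp
  then have "summable (\<lambda>n. complex_of_real (1 / (\<zeta> n)\<^sup>2) * cnj p ^ n * w ^ n)"
    by (intro summable_norm_cancel[where 'a = complex])
      (simp add: norm_mult norm_divide norm_power power_mult_distrib)
  then show ?thesis
    unfolding repr_kernel_def by (rule summable_sums)
qed

lemma taylor_coeff_kernel: "taylor_coeff (K p) n = complex_of_real (1 / (\<zeta> n)\<^sup>2) * cnj p ^ n"
  by (rule taylor_coeff_eqI[OF kernel_sums])

text \<open>The squared coefficient carries the weight to the power -4; multiplying by its square
  leaves the power -2, so the previous summability applies with \<open>r\<close> equal to
  \<open>(cmod p)\<^sup>2\<close>.\<close>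

lemma kernel_in_space: "K p \<in> H"
proof -
  have "summable (\<lambda>n. ((cmod p)\<^sup>2) ^ n / (\<zeta> n)\<^sup>2)"
    by (rule summable_power_div_weight) simp
  moreover have "(cmod (taylor_coeff (K p) n))\<^sup>2 * (\<zeta> n)\<^sup>2 = ((cmod p)\<^sup>2) ^ n / (\<zeta> n)\<^sup>2" for n
    by (simp add: taylor_coeff_kernel norm_mult norm_divide norm_power power2_eq_square
        power_mult_distrib)
  ultimately show ?thesis
    by (simp add: hardy_space_def holomorphic_on_UNIV_if_sums[OF kernel_sums])
qed

text \<open>The weight in the kernel coefficient cancels the weight of the inner product, leaving
  the Taylor series of \<open>f\<close> at \<open>p\<close>.\<close>

lemma inner_kernel:
  assumes "f \<in> H"
  shows "hardy_inner \<zeta> f (K p) = f p"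
proof -
  have eq: "taylor_coeff f n * cnj (taylor_coeff (K p) n) * complex_of_real ((\<zeta> n)\<^sup>2)
      = taylor_coeff f n * p ^ n" for n
    by (simp add: taylor_coeff_kernel)
  show ?thesis
    unfolding hardy_inner_def eq
    using taylor_coeff_sums[OF hardy_space_holomorphic[OF assms], of p] by (simp add: sums_iff)
qed

text \<open>Hermitian symmetry of the inner product of \<open>K p\<close> and \<open>K w\<close>,
  with both pairings evaluated by the reproducing property.\<close>

lemma kernel_cnj: "cnj (K p w) = K w p"
  by (metis inner_kernel hardy_inner_commute kernel_in_space)

text \<open>Only the term of index 0 survives. This constant is the source of the factor
  \<open>(\<zeta> 0)\<^sup>2\<close> in the formulas for the weights.\<close>

lemma kernel_0: "K 0 w = 1 / complex_of_real ((\<zeta> 0)\<^sup>2)" "K z 0 = 1 / complex_of_real ((\<zeta> 0)\<^sup>2)"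
proof -
  show "K z 0 = 1 / complex_of_real ((\<zeta> 0)\<^sup>2)" for z
    using powser_sums_zero[of "\<lambda>n. complex_of_real (1 / (\<zeta> n)\<^sup>2) * cnj z ^ n"] kernel_sums[of z 0]
    by (auto dest: sums_unique2)
  then show "K 0 w = 1 / complex_of_real ((\<zeta> 0)\<^sup>2)"
    by (metis kernel_cnj complex_cnj_complex_of_real complex_cnj_divide complex_cnj_one)
qed

section \<open>Adjoints and the functional equation\<close>

lemma hardy_adjoint_eqI:
  assumes "h \<in> H" and "\<And>f. f \<in> H \<Longrightarrow> hardy_inner \<zeta> (T f) g = hardy_inner \<zeta> f h"
  shows "hardy_adjoint \<zeta> T g = h"
  unfolding hardy_adjoint_def
proof (rule the_equality)
  fix k
  assume k: "k \<in> H \<and> (\<forall>f\<in>H. hardy_inner \<zeta> (T f) g = hardy_inner \<zeta> f k)"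
  show "k = h"
  proof (rule entire_eqI_taylor_coeff)
    fix n
    \<comment> \<open>For uniqueness it suffices to test on monomials: as \<open>\<zeta> n\<close>
      is nonzero, these pairings determine every Taylor coefficient.\<close>
    have "hardy_inner \<zeta> (\<lambda>z. z ^ n) k = hardy_inner \<zeta> (\<lambda>z. z ^ n) h"
      using k assms(2) hardy_space_monom by metis
    then show "taylor_coeff k n = taylor_coeff h n"
      by (simp add: hardy_inner_monom_left)
  qed (use k assms hardy_space_holomorphic in auto)
qed (use assms in auto)

text \<open>Pairing with \<open>K z\<close> evaluates at \<open>z\<close>, so the operator turns it
  into evaluation at \<open>\<Phi> z\<close> times \<open>\<Upsilon> z\<close>. That functional is
  again represented by a kernel, with the scalar conjugated in the second argument.\<close>

lemma adjoint_wcomp_kernel: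
  assumes "bounded_operator_on_hardy \<zeta> (wcomp \<Upsilon> \<Phi>)"
  shows "hardy_adjoint \<zeta> (wcomp \<Upsilon> \<Phi>) (K z) = (\<lambda>w. cnj (\<Upsilon> z) * K (\<Phi> z) w)"
proof (rule hardy_adjoint_eqI)
  show mem: "(\<lambda>w. cnj (\<Upsilon> z) * K (\<Phi> z) w) \<in> H"
    using hardy_space_lincomb[OF kernel_in_space kernel_in_space, of "cnj (\<Upsilon> z)" "\<Phi> z" 0] by simp
  fix f
  assume f: "f \<in> H"
  then have "wcomp \<Upsilon> \<Phi> f \<in> H"
    using assms by (simp add: bounded_operator_on_hardy_def)
  then have "hardy_inner \<zeta> (wcomp \<Upsilon> \<Phi> f) (K z) = \<Upsilon> z * f (\<Phi> z)"
    by (simp add: inner_kernel wcomp_def)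
  also have "\<dots> = hardy_inner \<zeta> f (\<lambda>w. cnj (\<Upsilon> z) * K (\<Phi> z) w)"
    by (subst hardy_inner_commute[OF mem f], subst hardy_inner_scale_left[OF kernel_in_space f],
        subst hardy_inner_commute[OF f kernel_in_space])
      (simp add: inner_kernel[OF f])
  finally show "hardy_inner \<zeta> (wcomp \<Upsilon> \<Phi> f) (K z)
    = hardy_inner \<zeta> f (\<lambda>w. cnj (\<Upsilon> z) * K (\<Phi> z) w)" .
qed

lemma adjoint_wcomp_eq_iff:
  assumes B1: "bounded_operator_on_hardy \<zeta> (wcomp \<Upsilon>\<^sub>1 \<Phi>\<^sub>1)"
    and B2: "bounded_operator_on_hardy \<zeta> (wcomp \<Upsilon>\<^sub>2 \<Phi>\<^sub>2)"
  shows "(\<forall>f \<in> H. hardy_adjoint \<zeta> (wcomp \<Upsilon>\<^sub>1 \<Phi>\<^sub>1) f = wcomp \<Upsilon>\<^sub>2 \<Phi>\<^sub>2 f) \<longleftrightarrow>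
    (\<forall>z w. cnj (\<Upsilon>\<^sub>1 z) * K (\<Phi>\<^sub>1 z) w = \<Upsilon>\<^sub>2 w * K z (\<Phi>\<^sub>2 w))" (is "?A \<longleftrightarrow> ?B")
proof
  assume A: ?A
  have "(\<lambda>w. cnj (\<Upsilon>\<^sub>1 z) * K (\<Phi>\<^sub>1 z) w) = wcomp \<Upsilon>\<^sub>2 \<Phi>\<^sub>2 (K z)" for z
    using A kernel_in_space adjoint_wcomp_kernel[OF B1] by metis
  then show ?B
    by (auto simp: wcomp_def fun_eq_iff)
next
  assume B: ?B
  let ?T1 = "wcomp \<Upsilon>\<^sub>1 \<Phi>\<^sub>1" and ?T2 = "wcomp \<Upsilon>\<^sub>2 \<Phi>\<^sub>2"
  have T1_kernel: "?T1 (K w) = (\<lambda>z. cnj (\<Upsilon>\<^sub>2 w) * K (\<Phi>\<^sub>2 w) z)" for w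
  proof
    fix z
    \<comment> \<open>Conjugating the functional equation exchanges the two arguments of each
      kernel, so it becomes a formula for the first operator on kernels.\<close>
    have "cnj (cnj (\<Upsilon>\<^sub>1 z) * K (\<Phi>\<^sub>1 z) w) = cnj (\<Upsilon>\<^sub>2 w * K z (\<Phi>\<^sub>2 w))"
      using B by simp
    then show "?T1 (K w) z = cnj (\<Upsilon>\<^sub>2 w) * K (\<Phi>\<^sub>2 w) z"
      by (simp add: kernel_cnj wcomp_def)
  qed
  show ?A
  proof
    fix g
    assume g: "g \<in> H"
    define l where "l n = hardy_inner \<zeta> (?T1 (\<lambda>z. z ^ n)) g" for n
    have T2g: "?T2 g \<in> H"
      using B2 g by (simp add: bounded_operator_on_hardy_def)
    have "(\<lambda>n. cnj (l n) / complex_of_real ((\<zeta> n)\<^sup>2) * w ^ n) sums ?T2 g w" for w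
    proof -
      have "hardy_inner \<zeta> (?T1 (K w)) g = cnj (\<Upsilon>\<^sub>2 w) * hardy_inner \<zeta> (K (\<Phi>\<^sub>2 w)) g"
        unfolding T1_kernel by (rule hardy_inner_scale_left[OF kernel_in_space g])
      also have "\<dots> = cnj (?T2 g w)"
        by (simp add: hardy_inner_commute[OF g kernel_in_space] inner_kernel[OF g] wcomp_def)
      finally have "(\<lambda>n. taylor_coeff (K w) n * l n) sums cnj (?T2 g w)"
        using bounded_operator_inner_sums[OF B1 kernel_in_space g, of w] by (simp add: l_def)
      \<comment> \<open>The kernel coefficients contain powers of \<open>cnj w\<close>. Conjugation
        makes this a power series in \<open>w\<close>, from which the Taylor coefficients of
        \<open>?T2 g\<close> can be read off.\<close>
      then have "(\<lambda>n. cnj (taylor_coeff (K w) n * l n)) sums cnj (cnj (?T2 g w))"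
        by (simp only: sums_cnj)
      then show ?thesis
        by (simp add: taylor_coeff_kernel mult_ac)
    qed
    then have coeff: "taylor_coeff (?T2 g) n = cnj (l n) / complex_of_real ((\<zeta> n)\<^sup>2)" for n
      by (rule taylor_coeff_eqI)
    show "hardy_adjoint \<zeta> ?T1 g = ?T2 g"
    proof (rule hardy_adjoint_eqI[OF T2g])
      fix f
      assume f: "f \<in> H"
      \<comment> \<open>Weights and conjugations cancel, so the inner product with
        \<open>?T2 g\<close> has the same terms as the expansion of the pairing of
        \<open>?T1 f\<close> with \<open>g\<close>.\<close>
      have eq: "taylor_coeff f n * cnj (taylor_coeff (?T2 g) n) * complex_of_real ((\<zeta> n)\<^sup>2)
          = taylor_coeff f n * l n" for n
        by (simp add: coeff)
      show "hardy_inner \<zeta> (?T1 f) g = hardy_inner \<zeta> f (?T2 g)"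
        unfolding hardy_inner_def[of _ f] eq
        using bounded_operator_inner_sums[OF B1 f g] by (simp add: sums_iff l_def)
    qed
  qed
qed

text \<open>Once the weight formulas are substituted, both sides of the functional equation share
  the factor \<open>(\<zeta> 0)\<^sup>2 * cnj (\<Upsilon>\<^sub>1 0)\<close>. If it vanishes the
  equation is trivial; otherwise it cancels and the kernel identity remains.\<close>

lemma functional_equation_iff:
  "(\<forall>z w. cnj (\<Upsilon>\<^sub>1 z) * K (\<Phi>\<^sub>1 z) w = \<Upsilon>\<^sub>2 w * K z (\<Phi>\<^sub>2 w)) \<longleftrightarrow>
    (\<forall>z. \<Upsilon>\<^sub>1 z = complex_of_real ((\<zeta> 0)\<^sup>2) * \<Upsilon>\<^sub>1 0 * K (\<Phi>\<^sub>2 0) z \<and>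
         \<Upsilon>\<^sub>2 z = complex_of_real ((\<zeta> 0)\<^sup>2) * cnj (\<Upsilon>\<^sub>1 0) * K (\<Phi>\<^sub>1 0) z) \<and>
    (\<Upsilon>\<^sub>1 0 \<noteq> 0 \<longrightarrow> (\<forall>z w. K z (\<Phi>\<^sub>2 0) * K (\<Phi>\<^sub>1 z) w = K (\<Phi>\<^sub>1 0) w * K z (\<Phi>\<^sub>2 w)))"
  (is "?E \<longleftrightarrow> ?W \<and> ?I")
proof -
  have weights: ?W if E: ?E
  proof -
    have U2: "\<Upsilon>\<^sub>2 w = complex_of_real ((\<zeta> 0)\<^sup>2) * cnj (\<Upsilon>\<^sub>1 0) * K (\<Phi>\<^sub>1 0) w" for w
      using E[rule_format, of 0 w] by (simp add: kernel_0 field_simps)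
    \<comment> \<open>At \<open>w = 0\<close> the equation involves
      \<open>\<Upsilon>\<^sub>2 0\<close>, which equals \<open>cnj (\<Upsilon>\<^sub>1 0)\<close> by
      \<open>U2\<close> and the value of the kernel at 0.\<close>
    have U1: "cnj (\<Upsilon>\<^sub>1 z) = complex_of_real ((\<zeta> 0)\<^sup>2) * cnj (\<Upsilon>\<^sub>1 0) * K z (\<Phi>\<^sub>2 0)" for z
      using E[rule_format, of z 0] by (simp add: U2[of 0] kernel_0 field_simps)
    have "\<Upsilon>\<^sub>1 z = complex_of_real ((\<zeta> 0)\<^sup>2) * \<Upsilon>\<^sub>1 0 * K (\<Phi>\<^sub>2 0) z" for z
      using arg_cong[OF U1[of z], of cnj]
      by (simp only: complex_cnj_cnj complex_cnj_mult complex_cnj_complex_of_real kernel_cnj)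
    then show ?W
      using U2 by blast
  qed
  have "?E \<longleftrightarrow> ?I" if W: ?W
  proof -
    let ?k = "complex_of_real ((\<zeta> 0)\<^sup>2) * cnj (\<Upsilon>\<^sub>1 0)"
    have U1: "cnj (\<Upsilon>\<^sub>1 z) = ?k * K z (\<Phi>\<^sub>2 0)" for z
      using W[rule_format, of z, THEN conjunct1, THEN arg_cong, of cnj]
      by (simp only: complex_cnj_mult complex_cnj_complex_of_real kernel_cnj)
    have "cnj (\<Upsilon>\<^sub>1 z) * K (\<Phi>\<^sub>1 z) w = \<Upsilon>\<^sub>2 w * K z (\<Phi>\<^sub>2 w) \<longleftrightarrow>
        ?k * (K z (\<Phi>\<^sub>2 0) * K (\<Phi>\<^sub>1 z) w) = ?k * (K (\<Phi>\<^sub>1 0) w * K z (\<Phi>\<^sub>2 w))" for z w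
      by (simp only: U1[of z] W[rule_format, of w, THEN conjunct2] mult.assoc)
    moreover have "?k = 0 \<longleftrightarrow> \<Upsilon>\<^sub>1 0 = 0"
      by simp
    ultimately show ?thesis
      by (metis mult_cancel_left)
  qed
  then show ?thesis
    using weights by blast
qed

end

theorem theorem2p3:
  fixes \<zeta> :: "nat \<Rightarrow> real"
    and \<mu> \<nu> c d :: complex
    and \<Phi>\<^sub>1 \<Phi>\<^sub>2 \<Upsilon>\<^sub>1 \<Upsilon>\<^sub>2 :: "complex \<Rightarrow> complex"
  assumes "\<And>n. \<zeta> n > 0"
    and "filterlim (\<lambda>n. root n (\<zeta> n)) at_top sequentially"
    and "cmod \<mu> \<le> 1" and "cmod \<nu> \<le> 1"
    and "\<And>z. \<Phi>\<^sub>1 z = \<mu> * z + c" and "\<And>z. \<Phi>\<^sub>2 z = \<nu> * z + d"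
    and "\<Upsilon>\<^sub>1 holomorphic_on UNIV" and "\<Upsilon>\<^sub>2 holomorphic_on UNIV"
    and "bounded_operator_on_hardy \<zeta> (wcomp \<Upsilon>\<^sub>1 \<Phi>\<^sub>1)"
    and "bounded_operator_on_hardy \<zeta> (wcomp \<Upsilon>\<^sub>2 \<Phi>\<^sub>2)"
  shows "(\<forall>f \<in> hardy_space \<zeta>. hardy_adjoint \<zeta> (wcomp \<Upsilon>\<^sub>1 \<Phi>\<^sub>1) f = wcomp \<Upsilon>\<^sub>2 \<Phi>\<^sub>2 f) \<longleftrightarrow>
    (\<forall>z. \<Upsilon>\<^sub>1 z = complex_of_real ((\<zeta> 0)\<^sup>2) * \<Upsilon>\<^sub>1 0 * repr_kernel \<zeta> (\<Phi>\<^sub>2 0) z \<and>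
         \<Upsilon>\<^sub>2 z = complex_of_real ((\<zeta> 0)\<^sup>2) * cnj (\<Upsilon>\<^sub>1 0) * repr_kernel \<zeta> (\<Phi>\<^sub>1 0) z) \<and>
    (\<Upsilon>\<^sub>1 0 = 0 \<longrightarrow>
       (\<forall>z. \<Upsilon>\<^sub>1 z = 0) \<and> (\<forall>z. \<Upsilon>\<^sub>2 z = 0) \<and>
       (\<forall>f \<in> hardy_space \<zeta>. wcomp \<Upsilon>\<^sub>1 \<Phi>\<^sub>1 f = (\<lambda>z. 0)) \<and>
       (\<forall>f \<in> hardy_space \<zeta>. wcomp \<Upsilon>\<^sub>2 \<Phi>\<^sub>2 f = (\<lambda>z. 0))) \<and>
    (\<Upsilon>\<^sub>1 0 \<noteq> 0 \<longrightarrow>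
       (\<forall>z w. repr_kernel \<zeta> z (\<Phi>\<^sub>2 0) * repr_kernel \<zeta> (\<Phi>\<^sub>1 z) w =
               repr_kernel \<zeta> (\<Phi>\<^sub>1 0) w * repr_kernel \<zeta> z (\<Phi>\<^sub>2 w)))"
proof -
  interpret entire_weight \<zeta>
    using assms(1,2) by unfold_locales
  \<comment> \<open>The clause for \<open>\<Upsilon>\<^sub>1 0 = 0\<close> follows from the weight
    formulas, which then make both weights zero; what remains is the combination of the two
    equivalences.\<close>
  show ?thesis
    unfolding adjoint_wcomp_eq_iff[OF assms(9,10)] functional_equation_iff
    by (auto simp: wcomp_def fun_eq_iff)
qed

end
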